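(* Every infinite-dimensional Fréchet space over $\mathbf{F}$, where $\mathbf{F}=\mathbb{R}$ or $\mathbf{F}=\mathbb{C}$, and in particular every infinite-dimensional Banach space over $\mathbf{F}$, has $\mathbb{T}^{\omega}$ as a quotient group.
   Context: A Fréchet space is a complete metrizable locally convex space. $\mathbb{T}$ denotes the compact unit circle group $\{z\in\mathbb{C}: |z|=1\}$ under multiplication with its usual topology, and $\mathbb{T}^{\omega}$ is the product of countably infinitely many copies of $\mathbb{T}$ (indexed by $\omega=\{0,1,2,\dots\}$) with the product topology and coordinatewise multiplication. A Fréchet space $E$ is regarded as a topological group under addition. A topological group $E$ has a topological group $G$ as a quotient group if $G$ is topologically isomorphic to $E/N$ (with the quotient topology) for some closed normal subgroup $N$ of $E$; equivalently (for Hausdorff $G$), there is a continuous open surjective group homomorphism $E\to G$. The homomorphism is not required to be linear in any sense, and $N$ need not be a vector subspace. *)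

theory Defs
  imports "HOL-Analysis.Analysis" "HOL-Algebra.Product_Groups"
begin

section \<open>Infinite-dimensional Frechet and Banach spaces\<close>

definition (in vector_space) infinite_dimensional :: bool
  where "infinite_dimensional \<longleftrightarrow> \<not> (\<exists>B. finite B \<and> span B = UNIV)"

text \<open>
  The scalar multiplication is an explicit parameter so that real and complex spaces are treated
  uniformly; only the instances \<^typ>\<open>real\<close> and \<^typ>\<open>complex\<close> of the scalar type are used.
  In the class \<^class>\<open>uniform_topological_group_add\<close> the uniformity is determined by the topology
  (two points are close iff their difference is close to 0), so \<^const>\<open>complete\<close>, which is
  stated for Cauchy filters, is completeness of the underlying topological group.
\<close>

locale frechet_space = vector_space scale
  for scale :: "'f::real_normed_field \<Rightarrow> 'a::{uniform_topological_group_add, ab_group_add} \<Rightarrow> 'a" +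
  assumes continuous_scale: "continuous_on UNIV (\<lambda>(c, x). scale c x)"
    and metrizable: "metrizable_space (euclidean :: 'a topology)"
    and complete_UNIV: "complete (UNIV :: 'a set)"
    and locally_convex: "\<And>U. open U \<Longrightarrow> 0 \<in> U \<Longrightarrow>
      \<exists>V. open V \<and> 0 \<in> V \<and> V \<subseteq> U \<and>
        (\<forall>x\<in>V. \<forall>y\<in>V. \<forall>u\<ge>0. \<forall>v\<ge>0. u + v = 1 \<longrightarrow>
          scale (of_real u) x + scale (of_real v) y \<in> V)"

text \<open>
  The class \<^class>\<open>banach\<close> provides the additive group and the complete norm. It also carries a
  real scalar multiplication; this imposes nothing on \<open>scale\<close>, since by continuity
  \<open>scale (of_real r) x = r *\<^sub>R x\<close> holds automatically.
\<close>

locale banach_space = vector_space scale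
  for scale :: "'f::real_normed_field \<Rightarrow> 'a::banach \<Rightarrow> 'a" +
  assumes norm_scale: "norm (scale c x) = norm c * norm x"

definition additive_group :: "'a::ab_group_add monoid"
  where "additive_group = \<lparr>carrier = UNIV, mult = (+), one = 0\<rparr>"

section \<open>Quotients of topological groups\<close>

text \<open>A topological group is given by a group \<open>G\<close> and a topology \<open>X\<close> on \<open>carrier G\<close>.\<close>

definition quotient_group_topology ::
    "('a, 'm) monoid_scheme \<Rightarrow> 'a topology \<Rightarrow> 'a set \<Rightarrow> 'a set topology"
  where "quotient_group_topology G X N =
    topology (\<lambda>U. U \<subseteq> carrier (G Mod N) \<and> openin X {x \<in> topspace X. N #>\<^bsub>G\<^esub> x \<in> U})"

lemma openin_quotient_group_topology:
  "openin (quotient_group_topology G X N) U \<longleftrightarrow>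
    U \<subseteq> carrier (G Mod N) \<and> openin X {x \<in> topspace X. N #>\<^bsub>G\<^esub> x \<in> U}"
proof -
  let ?P = "\<lambda>x. N #>\<^bsub>G\<^esub> x"
  have "istopology (\<lambda>U. U \<subseteq> carrier (G Mod N) \<and> openin X {x \<in> topspace X. ?P x \<in> U})"
    unfolding istopology_def
  proof (intro conjI allI impI)
    fix S T
    assume S: "S \<subseteq> carrier (G Mod N) \<and> openin X {x \<in> topspace X. ?P x \<in> S}"
      and T: "T \<subseteq> carrier (G Mod N) \<and> openin X {x \<in> topspace X. ?P x \<in> T}"
    show "S \<inter> T \<subseteq> carrier (G Mod N)"
      using S by blast
    have "{x \<in> topspace X. ?P x \<in> S \<inter> T} =
        {x \<in> topspace X. ?P x \<in> S} \<inter> {x \<in> topspace X. ?P x \<in> T}"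
      by blast
    then show "openin X {x \<in> topspace X. ?P x \<in> S \<inter> T}"
      using S T by (simp add: openin_Int)
  next
    fix K
    assume K: "\<forall>S\<in>K. S \<subseteq> carrier (G Mod N) \<and> openin X {x \<in> topspace X. ?P x \<in> S}"
    show "\<Union>K \<subseteq> carrier (G Mod N)"
      using K by blast
    have "{x \<in> topspace X. ?P x \<in> \<Union>K} = (\<Union>S\<in>K. {x \<in> topspace X. ?P x \<in> S})"
      by blast
    then show "openin X {x \<in> topspace X. ?P x \<in> \<Union>K}"
      using K by (auto intro: openin_Union)
  qed
  then show ?thesis
    by (simp add: quotient_group_topology_def)
qed

lemma quotient_map_quotient_group_topology:
  assumes "topspace X = carrier G"
  shows "quotient_map X (quotient_group_topology G X N) (\<lambda>x. N #>\<^bsub>G\<^esub> x)"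
proof -
  have "{x \<in> topspace X. N #>\<^bsub>G\<^esub> x \<in> carrier (G Mod N)} = topspace X"
    by (auto simp: carrier_FactGroup assms)
  then have "openin (quotient_group_topology G X N) (carrier (G Mod N))"
    by (simp add: openin_quotient_group_topology)
  then have "topspace (quotient_group_topology G X N) = carrier (G Mod N)"
    by (meson openin_quotient_group_topology openin_subset openin_topspace subset_antisym)
  then show ?thesis
    by (auto simp: quotient_map_def openin_quotient_group_topology carrier_FactGroup assms)
qed

definition topologically_isomorphic ::
    "('a, 'm) monoid_scheme \<Rightarrow> 'a topology \<Rightarrow> ('b, 'n) monoid_scheme \<Rightarrow> 'b topology \<Rightarrow> bool"
  where "topologically_isomorphic G X H Y \<longleftrightarrow> (\<exists>\<phi>\<in>iso G H. homeomorphic_map X Y \<phi>)"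

definition has_quotient_group ::
    "('a, 'm) monoid_scheme \<Rightarrow> 'a topology \<Rightarrow> ('b, 'n) monoid_scheme \<Rightarrow> 'b topology \<Rightarrow> bool"
  where "has_quotient_group G X H Y \<longleftrightarrow>
    (\<exists>N. N \<lhd> G \<and> closedin X N \<and>
      topologically_isomorphic (G Mod N) (quotient_group_topology G X N) H Y)"

section \<open>The group \<open>\<T>\<^sup>\<omega>\<close>\<close>

definition circle_group :: "complex monoid"
  where "circle_group = \<lparr>carrier = {z. norm z = 1}, mult = (*), one = 1\<rparr>"

definition circle_topology :: "complex topology"
  where "circle_topology = top_of_set (carrier circle_group)"

definition torus_group :: "(nat \<Rightarrow> complex) monoid"
  where "torus_group = product_group UNIV (\<lambda>_. circle_group)"

definition torus_topology :: "(nat \<Rightarrow> complex) topology"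
  where "torus_topology = product_topology (\<lambda>_. circle_topology) UNIV"

end

theory Submission
  imports Defs
begin

text \<open>
  Choose a biorthogonal sequence \<open>(e\<^sub>n, f\<^sub>n)\<close> of vectors and continuous real-linear functionals; it exists
  because in infinite dimension finitely many functionals have a common nonzero zero \<open>y\<close>, and the
  Hahn-Banach theorem gives a continuous functional not vanishing at \<open>y\<close>. Rescaling
  makes the \<open>e\<^sub>n\<close> so small that \<open>\<Sum>t\<^sub>n e\<^sub>n\<close> converges whenever all \<open>\<bar>t\<^sub>n\<bar> \<le> 1\<close>, so every such
  sequence \<open>t\<close> is interpolated by the \<open>f\<^sub>n\<close>. Since every angle is, modulo \<open>1\<close>, of absolute value at most \<open>1\<close>,
  the homomorphism \<open>x \<mapsto> (exp (2\<pi>i f\<^sub>n x))\<^sub>n\<close> maps onto the torus; it is open because a neighbourhood of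
  \<open>0\<close> contains all sums whose first few coefficients are small, the remaining ones being
  constrained only by \<open>\<bar>t\<^sub>n\<bar> \<le> 1\<close>.
\<close>

section \<open>The Hahn-Banach theorem\<close>

locale real_space = vector_space scale for scale :: "real \<Rightarrow> 'a::ab_group_add \<Rightarrow> 'a"
begin

definition sublinear :: "('a \<Rightarrow> real) \<Rightarrow> bool"
  where "sublinear q \<longleftrightarrow>
    (\<forall>x y. q (x + y) \<le> q x + q y) \<and> (\<forall>t\<ge>0. \<forall>x. q (scale t x) = t * q x)"

text \<open>The reverse inequality comes from \<open>le\<close> with factor \<open>1 / t\<close>,
  applied to \<open>scale t x\<close>.\<close>

lemma sublinearI:
  assumes add: "\<And>x y. q (x + y) \<le> q x + q y"
    and le: "\<And>t x. t > 0 \<Longrightarrow> q (scale t x) \<le> t * q x"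
    and zero: "q 0 = 0"
  shows "sublinear q"
proof -
  have "q (scale t x) = t * q x" if "t \<ge> 0" for t x
  proof (cases "t = 0")
    case False
    then have t: "t > 0"
      using that by simp
    have "q x = q (scale (1 / t) (scale t x))"
      using t by simp
    also have "\<dots> \<le> (1 / t) * q (scale t x)"
      using t by (intro le) simp
    finally have "t * q x \<le> q (scale t x)"
      using t by (simp add: field_simps)
    with le[OF t, of x] show ?thesis
      by simp
  qed (simp add: zero)
  with add show ?thesis
    by (simp add: sublinear_def)
qed

lemma sublinear_zero: "sublinear q \<Longrightarrow> q 0 = 0"
  unfolding sublinear_def by (metis mult_zero_left order_refl scale_zero_left)

lemma sublinear_neg:
  assumes "sublinear q"
  shows "- q (- x) \<le> q x"
proof -
  have "q (x + - x) \<le> q x + q (- x)"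
    using assms unfolding sublinear_def by blast
  with sublinear_zero[OF assms] show ?thesis
    by simp
qed

text \<open>Subadditivity at \<open>(a + scale t y) + (- a)\<close> bounds every term of the infimum
  below by \<open>- q (- a)\<close>, so the infimum is finite; \<open>t = 0\<close> and
  \<open>t = 1\<close> give the two upper bounds. The construction serves twice: it shows that
  minimal functionals are odd, and it prescribes a value at a chosen point.\<close>

lemma sublinear_shift:
  fixes x y :: 'a
  assumes q: "sublinear q"
  defines "r \<equiv> \<lambda>x. INF t\<in>{0..}. q (x + scale t y) - t * q y"
  shows "sublinear r" and "r x \<le> q x" and "r (- y) \<le> - q y"
proof -
  have add: "q (a + b) \<le> q a + q b" for a b
    using q unfolding sublinear_def by blast
  have hom: "t \<ge> 0 \<Longrightarrow> q (scale t a) = t * q a" for t a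
    using q unfolding sublinear_def by blast
  have lower: "- q (- a) \<le> q (a + scale t y) - t * q y" if "t \<ge> 0" for a t
    using add[of "a + scale t y" "- a"] hom[OF that, of y] by simp
  have bdd: "bdd_below ((\<lambda>t. q (a + scale t y) - t * q y) ` {0..})" for a
    using lower by (auto intro!: bdd_belowI2)
  have r_le: "r a \<le> q (a + scale t y) - t * q y" if "t \<ge> 0" for a t
    unfolding r_def using that by (intro cINF_lower bdd) auto
  have r_ge: "c \<le> r a" if "\<And>t. t \<ge> 0 \<Longrightarrow> c \<le> q (a + scale t y) - t * q y" for a c
    unfolding r_def using that by (intro cINF_greatest) auto
  have r_q: "r a \<le> q a" for a
    using r_le[of 0 a] by simp
  then show "r x \<le> q x" .
  show "r (- y) \<le> - q y"
    using r_le[of 1 "- y"] sublinear_zero[OF q] by simp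
  show "sublinear r"
  proof (rule sublinearI)
    fix a b
    \<comment> \<open>The parameter \<open>s + t\<close> serves the sum \<open>a + b\<close>; the
      infima over \<open>s\<close> and \<open>t\<close> are then taken one after the other.\<close>
    have "r (a + b) - (q (b + scale t y) - t * q y) \<le> q (a + scale s y) - s * q y"
      if s: "s \<ge> 0" and t: "t \<ge> 0" for s t
    proof -
      have "r (a + b) \<le> q ((a + b) + scale (s + t) y) - (s + t) * q y"
        using s t by (intro r_le) simp
      moreover have "(a + b) + scale (s + t) y = (a + scale s y) + (b + scale t y)"
        by (simp add: scale_left_distrib algebra_simps)
      ultimately show ?thesis
        using add[of "a + scale s y" "b + scale t y"] by (simp add: algebra_simps)
    qed
    then have "r (a + b) - (q (b + scale t y) - t * q y) \<le> r a" if "t \<ge> 0" for t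
      using that by (intro r_ge) auto
    then have "r (a + b) - r a \<le> r b"
      by (intro r_ge) (simp add: algebra_simps)
    then show "r (a + b) \<le> r a + r b"
      by simp
  next
    fix t :: real and a
    assume t: "t > 0"
    have "r (scale t a) / t \<le> r a"
    proof (rule r_ge)
      fix s :: real
      assume s: "s \<ge> 0"
      \<comment> \<open>The parameter \<open>t * s\<close> lets the factor \<open>t\<close> be
        pulled out of the argument of \<open>q\<close>.\<close>
      have "r (scale t a) \<le> q (scale t a + scale (t * s) y) - (t * s) * q y"
        using s t by (intro r_le) simp
      also have "scale t a + scale (t * s) y = scale t (a + scale s y)"
        by (simp add: scale_right_distrib)
      also have "q (scale t (a + scale s y)) = t * q (a + scale s y)"
        using t by (simp add: hom)
      finally show "r (scale t a) / t \<le> q (a + scale s y) - s * q y"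
        using t by (simp add: field_simps)
    qed
    then show "r (scale t a) \<le> t * r a"
      using t by (simp add: field_simps)
  next
    have "0 \<le> r 0"
      using lower[of _ 0] sublinear_zero[OF q] by (intro r_ge) simp
    with r_q[of 0] sublinear_zero[OF q] show "r 0 = 0"
      by simp
  qed
qed

text \<open>Any two members of a chain have one of them below both, and its subadditivity bounds the
  mixed sums \<open>q a + r b\<close>. The common majorant \<open>p\<close> keeps the infimum
  finite.\<close>

lemma sublinear_INF_chain:
  assumes C: "C \<noteq> {}" "\<And>q. q \<in> C \<Longrightarrow> sublinear q" "\<And>q. q \<in> C \<Longrightarrow> q \<le> p"
    and chain: "\<And>q r. q \<in> C \<Longrightarrow> r \<in> C \<Longrightarrow> q \<le> r \<or> r \<le> q"
  shows "sublinear (\<lambda>x. INF q\<in>C. q x)" and "q \<in> C \<Longrightarrow> (INF q\<in>C. q x) \<le> q x"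
proof -
  let ?u = "\<lambda>x. INF q\<in>C. q x"
  \<comment> \<open>A lower bound independent of \<open>q\<close>:
    \<open>- p (- a) \<le> - q (- a) \<le> q a\<close>.\<close>
  have "- p (- a) \<le> q a" if "q \<in> C" for q a
    using sublinear_neg[OF C(2)[OF that], of a] C(3)[OF that] by (smt (verit) le_fun_def)
  then have "bdd_below ((\<lambda>q. q a) ` C)" for a
    by (auto intro!: bdd_belowI2)
  then have u_le: "?u a \<le> q a" if "q \<in> C" for q a
    using that by (intro cINF_lower)
  then show "q \<in> C \<Longrightarrow> ?u x \<le> q x" .
  have u_ge: "c \<le> ?u a" if "\<And>q. q \<in> C \<Longrightarrow> c \<le> q a" for a c
    using that C(1) by (intro cINF_greatest)
  show "sublinear ?u"
  proof (rule sublinearI)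
    fix a b
    have "?u (a + b) \<le> q a + r b" if "q \<in> C" "r \<in> C" for q r
    proof -
      obtain s where s: "s \<in> C" "s \<le> q" "s \<le> r"
        using chain \<open>q \<in> C\<close> \<open>r \<in> C\<close> by blast
      have "?u (a + b) \<le> s (a + b)"
        using s by (intro u_le)
      also have "\<dots> \<le> s a + s b"
        using C(2)[OF s(1)] unfolding sublinear_def by blast
      also have "\<dots> \<le> q a + r b"
        using s by (intro add_mono) (auto simp: le_fun_def)
      finally show ?thesis .
    qed
    then have "?u (a + b) - r b \<le> ?u a" if "r \<in> C" for r
      using that by (intro u_ge) (simp add: algebra_simps)
    then have "?u (a + b) - ?u a \<le> ?u b"
      by (intro u_ge) (simp add: algebra_simps)
    then show "?u (a + b) \<le> ?u a + ?u b"
      by simp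
  next
    fix t :: real and a
    assume t: "t > 0"
    have "?u (scale t a) / t \<le> ?u a"
    proof (rule u_ge)
      fix q
      assume q: "q \<in> C"
      then have "?u (scale t a) \<le> q (scale t a)"
        by (rule u_le)
      also have "\<dots> = t * q a"
        using C(2)[OF q] t unfolding sublinear_def by simp
      finally show "?u (scale t a) / t \<le> q a"
        using t by (simp add: field_simps)
    qed
    then show "?u (scale t a) \<le> t * ?u a"
      using t by (simp add: field_simps)
  next
    have "(\<lambda>q. q 0) ` C = {0}"
      using C sublinear_zero by force
    then show "?u 0 = 0"
      by simp
  qed
qed

text \<open>
  The shifted functional of \<open>sublinear_shift\<close> lies below \<open>q\<close>, so by minimality equals \<open>q\<close>, which makes \<open>q\<close> odd.
\<close>

lemma linear_if_minimal_sublinear: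
  assumes q: "sublinear q"
    and minimal: "\<And>r. sublinear r \<Longrightarrow> r \<le> q \<Longrightarrow> r = q"
  shows "Vector_Spaces.linear scale (*) q"
proof -
  have odd: "q (- x) = - q x" for x
  proof -
    have eq: "(\<lambda>z. INF t\<in>{0..}. q (z + scale t x) - t * q x) = q"
      using sublinear_shift[OF q] by (intro minimal le_funI)
    have "q (- x) \<le> - q x"
      using sublinear_shift(3)[OF q, of x] fun_cong[OF eq, of "- x"] by simp
    with sublinear_neg[OF q, of x] show ?thesis
      by simp
  qed
  have add: "q (x + y) = q x + q y" for x y
  proof -
    have "q (x + y) \<le> q x + q y" "q (x + y + - y) \<le> q (x + y) + q (- y)"
      using q unfolding sublinear_def by blast+
    with odd[of y] show ?thesis
      by simp
  qed
  have "q (scale t x) = t * q x" for t x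
  proof (cases "t \<ge> 0")
    case True
    with q show ?thesis
      unfolding sublinear_def by blast
  next
    case False
    then have "q (scale (- t) x) = - t * q x"
      using q unfolding sublinear_def by (metis linorder_linear neg_0_le_iff_le)
    with odd[of "scale t x"] show ?thesis
      by (simp add: scale_minus_left)
  qed
  with add show ?thesis
    by unfold_locales (auto simp: algebra_simps)
qed

text \<open>Zorn's lemma yields a minimal sublinear functional below a shifted copy of
  \<open>p\<close>; minimality makes it linear.\<close>

lemma linear_functional_below_sublinear:
  assumes p: "sublinear p"
  shows "\<exists>f. Vector_Spaces.linear scale (*) f \<and> (\<forall>x. f x \<le> p x) \<and> p a \<le> f a"
proof -
  \<comment> \<open>Starting below \<open>p'\<close> instead of \<open>p\<close> forces equality at \<open>a\<close>.\<close>
  define p' where "p' = (\<lambda>x. INF t\<in>{0..}. p (x + scale t a) - t * p a)"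
  have p': "sublinear p'" "\<And>x. p' x \<le> p x" "p' (- a) \<le> - p a"
    unfolding p'_def by (fact sublinear_shift[OF p])+
  define A where "A = {q. sublinear q \<and> q \<le> p'}"
  \<comment> \<open>Zorn's lemma is used for the reversed order, so the upper bound of a chain is
    its pointwise infimum and a maximal element is a minimal functional.\<close>
  have "\<exists>m\<in>A. \<forall>q\<in>A. m \<ge> q \<longrightarrow> q = m"
  proof (rule predicate_Zorn)
    show "partial_order_on A (relation_of (\<ge>) A)"
      by (rule partial_order_on_relation_ofI) auto
  next
    fix C
    assume C: "C \<in> Chains (relation_of (\<ge>) A)"
    show "\<exists>u\<in>A. \<forall>q\<in>C. q \<ge> u"
    proof (cases "C = {}")
      case True
      with p' show ?thesis
        by (auto simp: A_def)
    next
      case False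
      have CA: "sublinear q" "q \<le> p'" if "q \<in> C" for q
        using C that by (auto simp: Chains_def relation_of_def A_def)
      have chain: "q \<le> r \<or> r \<le> q" if "q \<in> C" "r \<in> C" for q r
        using C that by (auto simp: Chains_def relation_of_def)
      let ?u = "\<lambda>x. INF q\<in>C. q x"
      have u: "sublinear ?u" "\<And>q x. q \<in> C \<Longrightarrow> ?u x \<le> q x"
        using sublinear_INF_chain[of C p', OF False CA chain] by auto
      moreover from u(2) have le: "\<forall>q\<in>C. ?u \<le> q"
        by (simp add: le_fun_def)
      moreover from False le CA(2) have "?u \<le> p'"
        by (metis (no_types, lifting) ex_in_conv order_trans)
      ultimately show ?thesis
        by (auto simp: A_def)
    qed
  qed
  then obtain m where m: "m \<in> A" and min: "\<And>q. q \<in> A \<Longrightarrow> q \<le> m \<Longrightarrow> q = m"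
    by blast
  have lin: "Vector_Spaces.linear scale (*) m"
    using m min by (intro linear_if_minimal_sublinear) (auto simp: A_def)
  interpret m: Vector_Spaces.linear scale "(*)" m
    by (fact lin)
  have le: "m x \<le> p' x" for x
    using m by (simp add: A_def le_fun_def)
  from le[of "- a"] p'(3) have "p a \<le> m a"
    by (simp add: m.neg)
  with lin le p'(2) show ?thesis
    by (meson order_trans)
qed

end

section \<open>Continuous functionals on real Frechet spaces\<close>

text \<open>
  Unlike \<^locale>\<open>frechet_space\<close>, this locale does not refer to a uniformity: \<^class>\<open>banach\<close> is not a
  subclass of \<^class>\<open>uniform_topological_group_add\<close>.
\<close>

locale real_frechet_space = real_space scale
  for scale :: "real \<Rightarrow> 'a::{topological_group_add, ab_group_add} \<Rightarrow> 'a" +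
  assumes continuous_scale: "continuous_on UNIV (\<lambda>(c, x). scale c x)"
    and metrizable: "metrizable_space (euclidean :: 'a topology)"
    and sequentially_complete: "\<And>S :: nat \<Rightarrow> 'a.
      (\<And>U. open U \<Longrightarrow> 0 \<in> U \<Longrightarrow> \<exists>N. \<forall>m\<ge>N. \<forall>n\<ge>N. S m - S n \<in> U) \<Longrightarrow> \<exists>z. S \<longlonglongrightarrow> z"
    and locally_convex: "\<And>U. open U \<Longrightarrow> 0 \<in> U \<Longrightarrow>
      \<exists>V. open V \<and> 0 \<in> V \<and> V \<subseteq> U \<and>
        (\<forall>x\<in>V. \<forall>y\<in>V. \<forall>u\<ge>0. \<forall>v\<ge>0. u + v = 1 \<longrightarrow> scale u x + scale v y \<in> V)"
begin

section \<open>Gauges of convex neighbourhoods\<close>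

lemma continuous_on_scale [continuous_intros]:
  assumes "continuous_on S c" "continuous_on S g"
  shows "continuous_on S (\<lambda>x. scale (c x) (g x))"
  using continuous_on_compose2[OF continuous_scale continuous_on_Pair[OF assms]] by simp

definition gauge :: "'a set \<Rightarrow> 'a \<Rightarrow> real"
  where "gauge V x = Inf {t. t > 0 \<and> scale (1 / t) x \<in> V}"

text \<open>Symmetry is not demanded: the gauge is then sublinear but perhaps no seminorm, and
  sublinearity is what the Hahn-Banach argument asks for.\<close>

definition convex_nbhd :: "'a set \<Rightarrow> bool"
  where "convex_nbhd V \<longleftrightarrow> open V \<and> 0 \<in> V \<and>
    (\<forall>x\<in>V. \<forall>y\<in>V. \<forall>u\<ge>0. \<forall>v\<ge>0. u + v = 1 \<longrightarrow> scale u x + scale v y \<in> V)"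

lemma convex_nbhd_exists: "open U \<Longrightarrow> 0 \<in> U \<Longrightarrow> \<exists>V\<subseteq>U. convex_nbhd V"
  using locally_convex[of U] by (auto simp: convex_nbhd_def)

lemma absorbing:
  assumes "open V" "0 \<in> V"
  shows "\<exists>d>0. \<forall>t. \<bar>t\<bar> \<le> d \<longrightarrow> scale t x \<in> V"
proof -
  have "open ((\<lambda>t. scale t x) -` V)"
    using assms(1) by (intro open_vimage continuous_intros)
  moreover have "0 \<in> (\<lambda>t. scale t x) -` V"
    using assms(2) by simp
  ultimately obtain d where "d > 0" "cball 0 d \<subseteq> (\<lambda>t. scale t x) -` V"
    by (meson open_contains_cball)
  then show ?thesis
    by (intro exI[of _ d]) (auto simp: subset_iff)
qed

lemma gauge_le: "t > 0 \<Longrightarrow> scale (1 / t) x \<in> V \<Longrightarrow> gauge V x \<le> t"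
  unfolding gauge_def by (intro cInf_lower bdd_belowI[of _ 0]) auto

text \<open>An open neighbourhood of \<open>0\<close> is absorbing, so the set in
  \<open>gauge\<close> is nonempty and its infimum is meaningful.\<close>

lemma gauge_ge:
  assumes V: "open V" "0 \<in> V"
    and c: "\<And>t. t > 0 \<Longrightarrow> scale (1 / t) x \<in> V \<Longrightarrow> c \<le> t"
  shows "c \<le> gauge V x"
proof -
  obtain d where d: "d > 0" "\<forall>t. \<bar>t\<bar> \<le> d \<longrightarrow> scale t x \<in> V"
    using absorbing[OF V] by blast
  then have "1 / d \<in> {t. t > 0 \<and> scale (1 / t) x \<in> V}"
    by simp
  then have "{t. t > 0 \<and> scale (1 / t) x \<in> V} \<noteq> {}"
    by blast
  then show ?thesis
    unfolding gauge_def using c by (intro cInf_greatest) auto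
qed

text \<open>For subadditivity, \<open>(x + y) / (s + t)\<close> is the convex combination of
  \<open>x / s\<close> and \<open>y / t\<close> with weights \<open>s / (s + t)\<close> and
  \<open>t / (s + t)\<close>.\<close>

lemma sublinear_gauge:
  assumes V: "convex_nbhd V"
  shows "sublinear (gauge V)"
proof (rule sublinearI)
  have V0: "open V" "0 \<in> V"
    using V by (auto simp: convex_nbhd_def)
  {
    fix x y
    have *: "gauge V (x + y) \<le> s + t"
      if s: "s > 0" "scale (1 / s) x \<in> V" and t: "t > 0" "scale (1 / t) y \<in> V" for s t
    proof (rule gauge_le)
      have "s / (s + t) \<ge> 0" "t / (s + t) \<ge> 0" "s / (s + t) + t / (s + t) = 1"
        using s t by (auto simp flip: add_divide_distrib)
      then have "scale (s / (s + t)) (scale (1 / s) x) + scale (t / (s + t)) (scale (1 / t) y) \<in> V"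
        using V s(2) t(2) unfolding convex_nbhd_def by blast
      then show "scale (1 / (s + t)) (x + y) \<in> V"
        using s t by (simp add: scale_right_distrib)
    qed (use s t in simp)
    have "gauge V (x + y) - t \<le> gauge V x" if "t > 0" "scale (1 / t) y \<in> V" for t
      using *[OF _ _ that] by (intro gauge_ge[OF V0]) (simp add: algebra_simps)
    then have "gauge V (x + y) - gauge V x \<le> gauge V y"
      by (intro gauge_ge[OF V0]) (simp add: algebra_simps)
    then show "gauge V (x + y) \<le> gauge V x + gauge V y"
      by simp
  next
    fix u :: real and x
    assume u: "u > 0"
    have "gauge V (scale u x) / u \<le> gauge V x"
    proof (rule gauge_ge[OF V0])
      fix t :: real
      assume t: "t > 0" "scale (1 / t) x \<in> V"
      have "gauge V (scale u x) \<le> u * t"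
        using t u by (intro gauge_le) auto
      then show "gauge V (scale u x) / u \<le> t"
        using u by (simp add: field_simps)
    qed
    then show "gauge V (scale u x) \<le> u * gauge V x"
      using u by (simp add: field_simps)
  next
    have "gauge V 0 \<le> t" if "t > 0" for t
      using that V0 by (intro gauge_le) auto
    then have "gauge V 0 \<le> 0"
      by (metis add_0 field_le_epsilon)
    moreover have "0 \<le> gauge V 0"
      by (intro gauge_ge[OF V0]) simp
    ultimately show "gauge V 0 = 0"
      by simp
  }
qed

section \<open>The continuous dual\<close>

definition dual :: "('a \<Rightarrow> real) set"
  where "dual = {f. Vector_Spaces.linear scale (*) f \<and> continuous_on UNIV f}"

text \<open>By linearity a one-sided bound on a neighbourhood of \<open>0\<close> scales down to
  arbitrarily small bounds near any point.\<close>

lemma dualI_bounded: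
  assumes f: "Vector_Spaces.linear scale (*) f"
    and V: "open V" "0 \<in> V" "\<And>x. x \<in> V \<Longrightarrow> f x \<le> 1"
  shows "f \<in> dual"
proof -
  interpret f: Vector_Spaces.linear scale "(*)" f
    by (fact f)
  have "(f \<longlongrightarrow> f x) (at x)" for x
  proof (rule tendstoI)
    fix e :: real
    assume e: "e > 0"
    \<comment> \<open>Since \<open>V\<close> may fail to be symmetric, both differences are scaled
      into it; together they bound the distance of the values by \<open>e / 2\<close>.\<close>
    let ?S = "(\<lambda>y. scale (2 / e) (y - x)) -` V \<inter> (\<lambda>y. scale (2 / e) (x - y)) -` V"
    have "open ?S"
      using V(1) by (intro open_Int open_vimage continuous_intros)
    moreover have "x \<in> ?S"
      using V(2) by simp
    moreover have "dist (f y) (f x) < e" if "y \<in> ?S" for y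
    proof -
      have "f (scale (2 / e) (y - x)) \<le> 1" "f (scale (2 / e) (x - y)) \<le> 1"
        using that V(3) by auto
      then have "f y - f x \<le> e / 2" "f x - f y \<le> e / 2"
        using e unfolding f.scale f.diff by (simp_all add: field_simps)
      with e show ?thesis
        by (simp add: dist_real_def abs_less_iff)
    qed
    ultimately show "\<forall>\<^sub>F y in at x. dist (f y) (f x) < e"
      unfolding eventually_at_topological by blast
  qed
  with f show ?thesis
    by (simp add: dual_def continuous_on_def)
qed

text \<open>A convex neighbourhood \<open>V\<close> avoiding \<open>x\<close> has gauge at least
  \<open>1\<close> at \<open>x\<close>. A linear functional below the gauge that reaches it at
  \<open>x\<close> is nonzero there, and continuous because it is at most \<open>1\<close> on
  \<open>V\<close>.\<close>

lemma dual_separates_zero: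
  assumes "x \<noteq> 0"
  shows "\<exists>f\<in>dual. f x \<noteq> 0"
proof -
  have "Hausdorff_space (euclidean :: 'a topology)"
    using metrizable by (rule metrizable_imp_Hausdorff_space)
  then obtain U where U: "open U" "0 \<in> U" "x \<notin> U"
    using assms unfolding Hausdorff_space_def by (metis disjnt_iff open_openin iso_tuple_UNIV_I topspace_euclidean)
  then obtain V where V: "V \<subseteq> U" "convex_nbhd V"
    using convex_nbhd_exists by blast
  then have V0: "open V" "0 \<in> V" "x \<notin> V"
    using U by (auto simp: convex_nbhd_def)
  obtain f where f: "Vector_Spaces.linear scale (*) f" "\<And>y. f y \<le> gauge V y" "gauge V x \<le> f x"
    using linear_functional_below_sublinear[OF sublinear_gauge[OF V(2)]] by blast
  \<comment> \<open>If \<open>scale (1 / t) x\<close> were in \<open>V\<close> with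
    \<open>t < 1\<close>, convexity would put \<open>x\<close> on the segment from \<open>0\<close>
    to it, hence in \<open>V\<close>.\<close>
  have "1 \<le> gauge V x"
  proof (rule gauge_ge[OF V0(1,2)], rule ccontr)
    fix t :: real
    assume t: "t > 0" "scale (1 / t) x \<in> V" "\<not> 1 \<le> t"
    have "t \<ge> 0" "1 - t \<ge> 0" "t + (1 - t) = 1"
      using t by auto
    then have "scale t (scale (1 / t) x) + scale (1 - t) 0 \<in> V"
      using V(2) t(2) V0(2) unfolding convex_nbhd_def by blast
    with t V0 show False
      by simp
  qed
  with f(3) have "f x \<noteq> 0"
    by linarith
  moreover have "f y \<le> 1" if "y \<in> V" for y
    using f(2)[of y] gauge_le[of 1 y V] that by simp
  then have "f \<in> dual"
    using f(1) V0 by (intro dualI_bounded)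
  ultimately show ?thesis
    by blast
qed

text \<open>A nonzero common zero \<open>y\<close> of the given functionals is the new vector; a
  functional \<open>h\<close> that does not vanish at \<open>y\<close> is corrected to vanish at the
  old vectors.\<close>

lemma biorthogonal_extend:
  fixes n :: nat
  assumes inf: "infinite_dimensional"
    and f: "\<And>k. k < n \<Longrightarrow> f k \<in> dual"
    and bi: "\<And>j k. j < n \<Longrightarrow> k < n \<Longrightarrow> f j (x k) = (if j = k then 1 else 0)"
  shows "\<exists>y. \<exists>g\<in>dual. g y = 1 \<and> (\<forall>k<n. g (x k) = 0 \<and> f k y = 0)"
proof -
  have lin: "Vector_Spaces.linear scale (*) (f k)" if "k < n" for k
    using f[OF that] by (simp add: dual_def)
  have "\<exists>y. y \<noteq> 0 \<and> (\<forall>k<n. f k y = 0)"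
  proof (rule ccontr)
    assume no: "\<not> ?thesis"
    have "z \<in> span (x ` {..<n})" for z
    proof -
      \<comment> \<open>The projection of \<open>z\<close> onto the span of the \<open>x k\<close>.
        The remainder is killed by every \<open>f j\<close>, so without a nonzero common zero it is
        \<open>0\<close> and finitely many vectors span the space.\<close>
      let ?s = "\<Sum>k<n. scale (f k z) (x k)"
      have "f j (z - ?s) = 0" if j: "j < n" for j
      proof -
        interpret fj: Vector_Spaces.linear scale "(*)" "f j"
          using lin[OF j] .
        have "f j ?s = (\<Sum>k<n. f k z * f j (x k))"
          by (simp add: fj.sum fj.scale)
        also have "\<dots> = (\<Sum>k<n. if j = k then f k z else 0)"
          using j bi by (intro sum.cong) auto
        also have "\<dots> = f j z"
          using j by simp
        finally show ?thesis
          by (simp add: fj.diff)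
      qed
      with no have "z - ?s = 0"
        by blast
      then have "z = ?s"
        by simp
      also have "?s \<in> span (x ` {..<n})"
        by (intro span_sum span_scale span_base) auto
      finally show ?thesis .
    qed
    then show False
      using inf unfolding infinite_dimensional_def by blast
  qed
  then obtain y where y: "y \<noteq> 0" "\<And>k. k < n \<Longrightarrow> f k y = 0"
    by blast
  then obtain h where h: "h \<in> dual" "h y \<noteq> 0"
    using dual_separates_zero by blast
  \<comment> \<open>Subtraction removes the values at the \<open>x k\<close>. It leaves the value at
    \<open>y\<close> alone since \<open>f k y = 0\<close>, so division by \<open>h y\<close>
    normalises it to \<open>1\<close>.\<close>
  define g where "g = (\<lambda>z. (h z - (\<Sum>k<n. h (x k) * f k z)) / h y)"
  have "g y = 1"
    using h y by (simp add: g_def)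
  moreover have "g (x k) = 0" if "k < n" for k
  proof -
    have "(\<Sum>j<n. h (x j) * f j (x k)) = (\<Sum>j<n. if j = k then h (x j) else 0)"
      using that bi by (intro sum.cong) auto
    then show ?thesis
      using that by (simp add: g_def)
  qed
  moreover have "g \<in> dual"
  proof -
    interpret h: Vector_Spaces.linear scale "(*)" h
      using h by (simp add: dual_def)
    have add: "f k (a + b) = f k a + f k b" and hom: "f k (scale t a) = t * f k a" if "k < n" for k a b t
    proof -
      interpret fk: Vector_Spaces.linear scale "(*)" "f k"
        using lin[OF that] .
      show "f k (a + b) = f k a + f k b" "f k (scale t a) = t * f k a"
        by (simp_all add: fk.add fk.scale)
    qed
    have "g (a + b) = g a + g b" for a b
      by (simp add: g_def h.add add sum.distrib distrib_left add_divide_distrib diff_divide_distrib)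
    moreover have "g (scale t a) = t * g a" for t a
      by (simp add: g_def h.scale hom sum_distrib_left algebra_simps)
    moreover have "continuous_on UNIV g"
      unfolding g_def using h f by (intro continuous_intros) (auto simp: dual_def)
    ultimately show ?thesis
      using h(1) unfolding dual_def Vector_Spaces.linear_iff by blast
  qed
  ultimately show ?thesis
    using y(2) by blast
qed

text \<open>Vectors and functionals are chosen as pairs by course-of-values recursion;
  \<open>P s n\<close> reads \<open>s\<close> only below \<open>n\<close>.\<close>

lemma biorthogonal_sequence:
  assumes "infinite_dimensional"
  shows "\<exists>(x :: nat \<Rightarrow> 'a) f. \<forall>m n. f m \<in> dual \<and> f m (x n) = (if m = n then 1 else 0)"
proof -
  define P :: "(nat \<Rightarrow> 'a \<times> ('a \<Rightarrow> real)) \<Rightarrow> nat \<Rightarrow> 'a \<times> ('a \<Rightarrow> real) \<Rightarrow> bool"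
    where "P s n r \<longleftrightarrow> snd r \<in> dual \<and> snd r (fst r) = 1 \<and>
      (\<forall>k<n. snd r (fst (s k)) = 0 \<and> snd (s k) (fst r) = 0)" for s n r
  have "\<exists>s. \<forall>n. P s n (s n)"
  proof (rule dependent_wellorder_choice)
    show "P s n r = P t n r" if "\<And>k. k < n \<Longrightarrow> s k = t k" for r s t n
      using that by (simp add: P_def)
  next
    fix n s
    assume s: "\<And>k. k < n \<Longrightarrow> P s k (s k)"
    have "snd (s j) (fst (s k)) = (if j = k then 1 else 0)" if "j < n" "k < n" for j k
      using s[OF that(1)] s[OF that(2)] by (cases j k rule: linorder_cases) (auto simp: P_def)
    then obtain y g where "g \<in> dual" "g y = 1" "\<forall>k<n. g (fst (s k)) = 0 \<and> snd (s k) y = 0"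
      using biorthogonal_extend[OF assms, of n "\<lambda>k. snd (s k)" "\<lambda>k. fst (s k)"] s
      by (auto simp: P_def)
    then show "\<exists>r. P s n r"
      by (intro exI[of _ "(y, g)"]) (simp add: P_def)
  qed
  then obtain s where s: "\<And>n. P s n (s n)"
    by blast
  have "snd (s m) \<in> dual \<and> snd (s m) (fst (s n)) = (if m = n then 1 else 0)" for m n
    using s[of m] s[of n] by (cases m n rule: linorder_cases) (auto simp: P_def)
  then show ?thesis
    by (intro exI[of _ "\<lambda>n. fst (s n)"] exI[of _ "\<lambda>n. snd (s n)"]) simp
qed

end

section \<open>Interpolation by small vectors\<close>

context real_frechet_space
begin

text \<open>A neighbourhood base at \<open>0\<close> that plays the part of balls of radius
  \<open>2^-n\<close> for a translation-invariant metric.\<close>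

definition halving_base :: "(nat \<Rightarrow> 'a set) \<Rightarrow> bool"
  where "halving_base V \<longleftrightarrow>
    (\<forall>n. open (V n) \<and> 0 \<in> V n \<and> (\<forall>a\<in>V (Suc n). \<forall>b\<in>V (Suc n). a + b \<in> V n)) \<and>
    (\<forall>U. open U \<longrightarrow> 0 \<in> U \<longrightarrow> (\<exists>n. V n \<subseteq> U))"

text \<open>Metrizability gives a countable base at \<open>0\<close>; continuity of addition at
  \<open>(0, 0)\<close> allows each next set to be chosen small enough.\<close>

lemma halving_base_exists: "\<exists>V. halving_base V"
proof -
  have "first_countable (euclidean :: 'a topology)"
    using metrizable by (rule metrizable_imp_first_countable)
  then obtain \<B> where \<B>: "countable \<B>" "\<And>V. V \<in> \<B> \<Longrightarrow> open V"
      "\<And>U. open U \<Longrightarrow> 0 \<in> U \<Longrightarrow> \<exists>V\<in>\<B>. (0::'a) \<in> V \<and> V \<subseteq> U"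
    unfolding first_countable_def by (metis UNIV_I open_openin topspace_euclidean)
  define \<C> where "\<C> = {V \<in> \<B>. 0 \<in> V}"
  have "countable \<C>" "\<C> \<noteq> {}"
    using \<B>(1) \<B>(3)[of UNIV] by (auto simp: \<C>_def)
  then obtain C where C: "\<C> = range (C :: nat \<Rightarrow> 'a set)"
    by (metis uncountable_def)
  have C_open: "open (C n)" "0 \<in> C n" for n
    using \<B>(2) rangeI[of C n] unfolding C[symmetric] by (auto simp: \<C>_def)
  have "\<exists>V. \<forall>n. (open (V n) \<and> 0 \<in> V n \<and> V n \<subseteq> C n) \<and>
      (\<forall>a\<in>V (Suc n). \<forall>b\<in>V (Suc n). a + b \<in> V n)"
  proof (rule dependent_nat_choice)
    show "\<exists>V. open V \<and> 0 \<in> V \<and> V \<subseteq> C 0"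
      using C_open by blast
  next
    fix V n
    assume V: "open V \<and> 0 \<in> V \<and> V \<subseteq> C n"
    have "open ((\<lambda>p. fst p + snd p) -` V)"
      using V by (intro open_vimage continuous_intros) auto
    moreover have "(0, 0) \<in> (\<lambda>p. fst p + snd p) -` V"
      using V by simp
    ultimately obtain A B where AB: "open A" "open B" "0 \<in> A" "0 \<in> B"
        "A \<times> B \<subseteq> (\<lambda>p. fst p + snd p) -` V"
      by (rule open_prod_elim) auto
    then show "\<exists>W. (open W \<and> 0 \<in> W \<and> W \<subseteq> C (Suc n)) \<and> (\<forall>a\<in>W. \<forall>b\<in>W. a + b \<in> V)"
      using C_open[of "Suc n"] by (intro exI[of _ "A \<inter> B \<inter> C (Suc n)"]) fastforce
  qed
  then obtain V where V: "\<forall>n. (open (V n) \<and> 0 \<in> V n \<and> V n \<subseteq> C n) \<and>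
      (\<forall>a\<in>V (Suc n). \<forall>b\<in>V (Suc n). a + b \<in> V n)" ..
  have "\<exists>n. V n \<subseteq> U" if U: "open U" "0 \<in> U" for U
  proof -
    obtain W where "W \<in> \<C>" "W \<subseteq> U"
      using \<B>(3)[OF U] by (auto simp: \<C>_def)
    then obtain n where "C n \<subseteq> U"
      by (auto simp: C)
    with V show ?thesis
      by blast
  qed
  with V show ?thesis
    by (intro exI[of _ V]) (auto simp: halving_base_def)
qed

context
  fixes V
  assumes V: "halving_base V"
begin

lemma halving_base_open: "open (V n)"
  and halving_base_zero: "0 \<in> V n"
  and halving_base_add: "a \<in> V (Suc n) \<Longrightarrow> b \<in> V (Suc n) \<Longrightarrow> a + b \<in> V n"
  and halving_base_subset: "open U \<Longrightarrow> 0 \<in> U \<Longrightarrow> \<exists>n. V n \<subseteq> U"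
  using V unfolding halving_base_def by blast+

lemma halving_base_antimono: "m \<le> n \<Longrightarrow> V n \<subseteq> V m"
  by (rule lift_Suc_antimono_le) (use halving_base_add halving_base_zero in fastforce)

text \<open>Downward induction on \<open>m\<close>: the term \<open>y m\<close> and the remaining
  sum both lie in \<open>V (Suc (m + p))\<close>. The offset \<open>p\<close> is \<open>0\<close>
  for tails and larger when an initial segment must be small.\<close>

lemma sum_in_halving_base:
  assumes "m \<le> n" and "\<And>k. m \<le> k \<Longrightarrow> k < n \<Longrightarrow> y k \<in> V (Suc (k + p))"
  shows "sum y {m..<n} \<in> V (m + p)"
  using assms
proof (induction m rule: inc_induct)
  case base
  show ?case
    by (simp add: halving_base_zero)
next
  case (step m)
  have "y m + sum y {Suc m..<n} \<in> V (m + p)"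
    using step.IH step.prems step.hyps by (intro halving_base_add) auto
  with step.hyps show ?case
    by (simp add: sum.atLeast_Suc_lessThan)
qed

lemma halving_series_convergent:
  assumes y: "\<And>k. y k \<in> V (Suc k)"
  shows "\<exists>z. (\<lambda>n. \<Sum>k<n. y k) \<longlonglongrightarrow> z"
proof -
  let ?S = "\<lambda>n. \<Sum>k<n. y k"
  have diff: "?S n - ?S m = sum y {m..<n}" if "m \<le> n" for m n
    using sum_diff_nat_ivl[of 0 m n y] that by (simp add: lessThan_atLeast0)
  have tail: "sum y {m..<n} \<in> V N" if "N \<le> m" "m \<le> n" for m n N
    using sum_in_halving_base[OF that(2), of y 0] y halving_base_antimono[OF that(1)] by auto
  show ?thesis
  proof (rule sequentially_complete)
    fix U :: "'a set"
    assume U: "open U" "0 \<in> U"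
    \<comment> \<open>The tail estimate covers differences of one sign only, so \<open>U\<close> is
      made symmetric first.\<close>
    have "open (U \<inter> uminus -` U)"
      using U by (intro open_Int open_vimage continuous_intros)
    with U obtain N where N: "V N \<subseteq> U \<inter> uminus -` U"
      using halving_base_subset[of "U \<inter> uminus -` U"] by auto
    have "?S m - ?S n \<in> U" if mn: "m \<ge> N" "n \<ge> N" for m n
    proof (cases "n \<le> m")
      case True
      then show ?thesis
        using tail[OF mn(2) True] N diff[OF True] by auto
    next
      case False
      then have "- (?S m - ?S n) \<in> V N"
        using tail[of N m n] mn diff[of m n] by (simp add: minus_diff_eq)
      then show ?thesis
        using N by (metis IntE minus_minus subsetD vimageE)
    qed
    then show "\<exists>N. \<forall>m\<ge>N. \<forall>n\<ge>N. ?S m - ?S n \<in> U"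
      by blast
  qed
qed

end

text \<open>The second conjunct will give surjectivity onto the torus, the third openness:
  membership in \<open>U\<close> costs conditions on finitely many coefficients only.\<close>

lemma interpolating_functionals:
  assumes "infinite_dimensional"
  shows "\<exists>f :: nat \<Rightarrow> 'a \<Rightarrow> real. (\<forall>n. f n \<in> dual) \<and>
    (\<forall>t. (\<forall>n. \<bar>t n\<bar> \<le> 1) \<longrightarrow> (\<exists>z. \<forall>n. f n z = t n)) \<and>
    (\<forall>U. open U \<longrightarrow> 0 \<in> U \<longrightarrow> (\<exists>N::nat. \<exists>W. (\<forall>k. open (W k) \<and> 0 \<in> W k) \<and>
      (\<forall>t. (\<forall>n. \<bar>t n\<bar> \<le> 1) \<longrightarrow> (\<forall>k<N. t k \<in> W k) \<longrightarrow> (\<exists>z\<in>U. \<forall>n. f n z = t n))))"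
proof -
  obtain x :: "nat \<Rightarrow> 'a" and g
    where "\<forall>m n. g m \<in> dual \<and> g m (x n) = (if m = n then 1 else 0)"
    using biorthogonal_sequence[OF assms] by blast
  then have g: "\<And>n. g n \<in> dual" "\<And>m n. g m (x n) = (if m = n then 1 else 0)"
    by blast+
  obtain V where V: "halving_base V"
    using halving_base_exists by blast
  note V_add = halving_base_add[OF V] and V_open = halving_base_open[OF V]
  have "\<exists>d>0. \<forall>t. \<bar>t\<bar> \<le> d \<longrightarrow> scale t (x n) \<in> V (Suc n)" for n
    using absorbing halving_base_open[OF V] halving_base_zero[OF V] by blast
  then obtain d where d: "\<And>n. d n > 0" "\<And>n t. \<bar>t\<bar> \<le> d n \<Longrightarrow> scale t (x n) \<in> V (Suc n)"
    by metis
  \<comment> \<open>Shrinking \<open>x n\<close> by \<open>d n\<close> puts all multiples with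
    factor at most \<open>1\<close> in absolute value into \<open>V (Suc n)\<close>; dividing
    \<open>g n\<close> by \<open>d n\<close> preserves biorthogonality.\<close>
  define f where "f = (\<lambda>n z. g n z / d n)"
  define e where "e = (\<lambda>n. scale (d n) (x n))"
  have lin: "Vector_Spaces.linear scale (*) (f n)" for n
  proof -
    interpret gn: Vector_Spaces.linear scale "(*)" "g n"
      using g(1)[of n] by (simp add: dual_def)
    show ?thesis
      by unfold_locales (auto simp: f_def gn.add gn.scale add_divide_distrib algebra_simps)
  qed
  have dual: "f n \<in> dual" for n
    using lin g(1)[of n] d(1)[of n] unfolding dual_def f_def by (auto intro!: continuous_intros)
  have bi: "f m (e n) = (if m = n then 1 else 0)" for m n
  proof -
    interpret gm: Vector_Spaces.linear scale "(*)" "g m"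
      using g(1)[of m] by (simp add: dual_def)
    show ?thesis
      using d(1)[of n] by (simp add: f_def e_def gm.scale g(2))
  qed
  have small: "scale t (e n) \<in> V (Suc n)" if "\<bar>t\<bar> \<le> 1" for t n
    unfolding e_def scale_scale using that d(1)[of n]
    by (intro d(2)) (simp add: abs_mult mult_left_le_one_le)
  have interpolate: "\<exists>z. (\<lambda>n. \<Sum>k<n. scale (t k) (e k)) \<longlonglongrightarrow> z \<and> (\<forall>n. f n z = t n)"
    if t: "\<And>n. \<bar>t n\<bar> \<le> 1" for t
  proof -
    let ?S = "\<lambda>n. \<Sum>k<n. scale (t k) (e k)"
    obtain z where z: "?S \<longlonglongrightarrow> z"
      using halving_series_convergent[OF V] small t by meson
    have "f m z = t m" for m
    proof -
      interpret fm: Vector_Spaces.linear scale "(*)" "f m"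
        by (fact lin)
      have "continuous_on UNIV (f m)"
        using dual[of m] by (simp add: dual_def)
      then have "(\<lambda>n. f m (?S n)) \<longlonglongrightarrow> f m z"
        using z by (rule continuous_on_tendsto_compose) auto
      \<comment> \<open>Only the term with index \<open>m\<close> survives, so the values are
        constant from \<open>Suc m\<close> on.\<close>
      moreover have "f m (?S n) = t m" if "n > m" for n
      proof -
        have "f m (?S n) = (\<Sum>k<n. if m = k then t k else 0)"
          by (simp add: fm.sum fm.scale bi if_distrib cong: if_cong)
        with that show ?thesis
          by simp
      qed
      then have "(\<lambda>n. f m (?S n)) \<longlonglongrightarrow> t m"
        by (intro tendsto_eventually eventually_sequentiallyI[of "Suc m"]) simp
      ultimately show ?thesis
        by (rule LIMSEQ_unique)
    qed
    with z show ?thesis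
      by blast
  qed
  show ?thesis
  proof (intro exI[of _ f] conjI allI impI)
    show "f n \<in> dual" for n
      by (fact dual)
    show "\<exists>z. \<forall>n. f n z = t n" if "\<forall>n. \<bar>t n\<bar> \<le> 1" for t
      using interpolate[of t] that by blast
  next
    fix U :: "'a set"
    assume "open U" "0 \<in> U"
    then obtain m where m: "V m \<subseteq> U"
      using halving_base_subset[OF V] by blast
    \<comment> \<open>Two levels are kept in reserve: tail and remainder lie in \<open>V M\<close>,
      their sum in \<open>V (Suc m)\<close>, and adding the head gives \<open>V m\<close>. The sets
      \<open>W k\<close> force the head itself into \<open>V M\<close>.\<close>
    define M where "M = Suc (Suc m)"
    define W where "W k = (\<lambda>t. scale t (e k)) -` V (Suc (k + M))" for k
    have W: "\<forall>k. open (W k) \<and> 0 \<in> W k"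
      unfolding W_def using V_open halving_base_zero[OF V]
      by (auto intro!: open_vimage continuous_intros)
    have "\<exists>z\<in>U. \<forall>n. f n z = t n" if t: "\<And>n. \<bar>t n\<bar> \<le> 1" and tW: "\<And>k. k < M \<Longrightarrow> t k \<in> W k" for t
    proof -
      let ?y = "\<lambda>k. scale (t k) (e k)"
      obtain z where z: "(\<lambda>n. \<Sum>k<n. ?y k) \<longlonglongrightarrow> z" "\<And>n. f n z = t n"
        using interpolate[of t] t by blast
      have "((\<lambda>n. z - (\<Sum>k<n. ?y k)) \<longlonglongrightarrow> z - z)"
        by (intro tendsto_intros z)
      then have "\<forall>\<^sub>F n in sequentially. z - (\<Sum>k<n. ?y k) \<in> V M"
        using topological_tendstoD V_open halving_base_zero[OF V] by fastforce
      then obtain n where n: "n \<ge> M" "z - (\<Sum>k<n. ?y k) \<in> V M"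
        unfolding eventually_sequentially by (meson nat_le_linear)
      have "(\<Sum>k<n. ?y k) = sum ?y {0..<M} + sum ?y {M..<n}"
        using n(1) by (simp add: sum.atLeastLessThan_concat lessThan_atLeast0)
      then have "z = sum ?y {0..<M} + (sum ?y {M..<n} + (z - (\<Sum>k<n. ?y k)))"
        by (simp add: algebra_simps)
      moreover have "sum ?y {0..<M} \<in> V (Suc m)"
      proof -
        have "sum ?y {0..<M} \<in> V (0 + M)"
          using tW by (intro sum_in_halving_base[OF V]) (auto simp: W_def)
        then show ?thesis
          using halving_base_antimono[OF V, of "Suc m" M] by (auto simp: M_def)
      qed
      moreover have "sum ?y {M..<n} \<in> V M"
        using sum_in_halving_base[OF V n(1), of ?y 0] small t by simp
      then have "sum ?y {M..<n} + (z - (\<Sum>k<n. ?y k)) \<in> V (Suc m)"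
        using n(2) unfolding M_def by (intro V_add)
      ultimately have "z \<in> V m"
        using V_add by metis
      with m z(2) show ?thesis
        by blast
    qed
    with W show "\<exists>N W. (\<forall>k. open (W k) \<and> 0 \<in> W k) \<and>
      (\<forall>t. (\<forall>n. \<bar>t n\<bar> \<le> 1) \<longrightarrow> (\<forall>k<N. t k \<in> W k) \<longrightarrow> (\<exists>z\<in>U. \<forall>n. f n z = t n))"
      by blast
  qed
qed

end

section \<open>Quotients and the torus\<close>

text \<open>The first isomorphism theorem with topology: a continuous open surjection is a quotient
  map, so the bijection it induces on cosets is an injective quotient map, that is, a homeomorphism.
  The kernel is closed because points of \<open>Y\<close> are.\<close>

lemma has_quotient_group_if_open_hom:
  assumes G: "group G" "topspace X = carrier G"
    and H: "group H" "topspace Y = carrier H" "t1_space Y"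
    and h: "h \<in> hom G H" "continuous_map X Y h" "open_map X Y h" "h ` carrier G = carrier H"
  shows "has_quotient_group G X H Y"
proof -
  interpret group_hom G H h
    using G H h by (simp add: group_hom_def group_hom_axioms_def)
  let ?N = "kernel G H h"
  let ?q = "\<lambda>x. ?N #>\<^bsub>G\<^esub> x"
  let ?Q = "quotient_group_topology G X ?N"
  let ?\<psi> = "\<lambda>A. the_elem (h ` A)"
  have q: "quotient_map X ?Q ?q"
    using G(2) by (rule quotient_map_quotient_group_topology)
  then have topspace_Q: "topspace ?Q = carrier (G Mod ?N)"
    using G(2) by (auto simp: quotient_map_def carrier_FactGroup)
  \<comment> \<open>\<open>h\<close> is constant on each coset of its kernel, so
    \<open>the_elem\<close> picks that single value.\<close>
  have \<psi>q: "?\<psi> (?q x) = h x" if "x \<in> carrier G" for x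
  proof -
    have "h ` ?q x = {h x}"
      using that by (force simp: kernel_def r_coset_def)
    then show ?thesis
      by simp
  qed
  have "closedin X {x \<in> topspace X. h x \<in> {\<one>\<^bsub>H\<^esub>}}"
    using h(2) closedin_t1_singleton[OF H(3)] H.one_closed unfolding H(2)
    by (intro closedin_continuous_map_preimage)
  then have "closedin X ?N"
    by (simp add: kernel_def G(2))
  moreover have "?\<psi> \<in> iso (G Mod ?N) H"
    using h(4) by (rule FactGroup_iso_set)
  moreover have "homeomorphic_map ?Q Y ?\<psi>"
  proof -
    have "quotient_map X Y h"
      using h G(2) H(2) by (intro continuous_open_imp_quotient_map) auto
    then have \<psi>q_quotient: "quotient_map X Y (?\<psi> \<circ> ?q)"
      using \<psi>q G(2) by (elim quotient_map_eq) auto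
    then have "continuous_map ?Q Y ?\<psi>"
      using continuous_compose_quotient_map_eq[OF q] quotient_imp_continuous_map by blast
    then have "quotient_map ?Q Y ?\<psi>"
      using q \<psi>q_quotient by (meson quotient_imp_continuous_map quotient_map_from_composition)
    then show ?thesis
      unfolding homeomorphic_map_def topspace_Q using FactGroup_inj_on by simp
  qed
  ultimately show ?thesis
    unfolding has_quotient_group_def topologically_isomorphic_def using normal_kernel by blast
qed

section \<open>The additive group and the torus as topological groups\<close>

lemma group_additive_group: "group (additive_group :: 'a::ab_group_add monoid)"
proof (rule groupI)
  fix x :: 'a
  show "\<exists>y\<in>carrier additive_group. y \<otimes>\<^bsub>additive_group\<^esub> x = \<one>\<^bsub>additive_group\<^esub>"
    by (intro bexI[of _ "- x"]) (auto simp: additive_group_def)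
qed (auto simp: additive_group_def add.assoc)

lemma group_circle_group: "group circle_group"
proof (rule groupI)
  fix z
  assume z: "z \<in> carrier circle_group"
  then have "z \<noteq> 0"
    by (auto simp: circle_group_def)
  with z show "\<exists>w\<in>carrier circle_group. w \<otimes>\<^bsub>circle_group\<^esub> z = \<one>\<^bsub>circle_group\<^esub>"
    by (intro bexI[of _ "inverse z"]) (auto simp: circle_group_def norm_inverse)
qed (auto simp: circle_group_def norm_mult mult.assoc)

lemma group_torus_group: "group torus_group"
  by (simp add: torus_group_def group_circle_group)

lemma topspace_circle_topology: "topspace circle_topology = {z. norm z = 1}"
  by (simp add: circle_topology_def circle_group_def)

lemma carrier_torus_group: "carrier torus_group = {w. \<forall>n. norm (w n) = 1}"
  by (auto simp: torus_group_def circle_group_def)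

lemma topspace_torus_topology: "topspace torus_topology = {w. \<forall>n. norm (w n) = 1}"
  by (auto simp: torus_topology_def topspace_circle_topology)

lemma mult_torus_group: "v \<otimes>\<^bsub>torus_group\<^esub> w = (\<lambda>n. v n * w n)"
  by (simp add: torus_group_def circle_group_def fun_eq_iff)

lemma t1_space_torus_topology: "t1_space torus_topology"
  unfolding torus_topology_def circle_topology_def
  by (intro Hausdorff_imp_t1_space) (simp add: Hausdorff_space_product_topology Hausdorff_space_subtopology)

text \<open>Basic open sets of the product constrain finitely many coordinates; here an initial
  segment, by open sets of the plane.\<close>

lemma openin_torus_topologyI:
  assumes "S \<subseteq> topspace torus_topology"
    and S: "\<And>w. w \<in> S \<Longrightarrow> \<exists>N B. (\<forall>k::nat. open (B k) \<and> w k \<in> B k) \<and>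
      (\<forall>v\<in>topspace torus_topology. (\<forall>k<N. v k \<in> B k) \<longrightarrow> v \<in> S)"
  shows "openin torus_topology S"
  unfolding torus_topology_def openin_product_topology_alt
proof
  fix w
  assume w: "w \<in> S"
  obtain N B where B: "\<forall>k::nat. open (B k) \<and> w k \<in> B k"
    "\<forall>v\<in>topspace torus_topology. (\<forall>k<N. v k \<in> B k) \<longrightarrow> v \<in> S"
    using S[OF w] by (elim exE conjE)
  define U where "U k = (if k < N then topspace circle_topology \<inter> B k else topspace circle_topology)" for k
  have "openin circle_topology (U k)" for k
    unfolding U_def circle_topology_def using B(1) by (auto intro: openin_open_Int)
  moreover have "finite {k. U k \<noteq> topspace circle_topology}"
    by (rule finite_subset[of _ "{..<N}"]) (auto simp: U_def split: if_splits)
  moreover have "w \<in> Pi\<^sub>E UNIV U"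
    using w assms(1) B(1) by (auto simp: U_def topspace_torus_topology topspace_circle_topology)
  moreover have "Pi\<^sub>E UNIV U \<subseteq> S"
    using B(2) by (force simp: U_def topspace_torus_topology topspace_circle_topology PiE_iff split: if_splits)
  ultimately show "\<exists>U. finite {i \<in> UNIV. U i \<noteq> topspace circle_topology} \<and>
      (\<forall>i\<in>UNIV. openin circle_topology (U i)) \<and> w \<in> Pi\<^sub>E UNIV U \<and> Pi\<^sub>E UNIV U \<subseteq> S"
    by (intro exI[of _ U]) simp
qed

text \<open>\<open>Arg z / (2 * pi)\<close> is the angle in turns, with values between
  \<open>-1/2\<close> and \<open>1/2\<close>.\<close>

lemma cis_Arg_turn: "norm z = 1 \<Longrightarrow> cis (2 * pi * (Arg z / (2 * pi))) = z"
  using cis_Arg[of z] by (cases "z = 0") (simp_all add: sgn_div_norm)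

lemma abs_Arg_turn_le: "\<bar>Arg z / (2 * pi)\<bar> \<le> 1"
  using Arg_bounded[of z] pi_gt_zero by (simp add: abs_le_iff field_simps)

text \<open>The point \<open>1\<close> is off the branch cut of \<open>Arg\<close>, and
  \<open>Arg 1 = 0\<close>.\<close>

lemma continuous_Arg_turn:
  assumes "open W" "0 \<in> W"
  shows "\<exists>B. open B \<and> 1 \<in> B \<and> (\<forall>z\<in>B. Arg z / (2 * pi) \<in> W)"
proof -
  have "continuous (at 1) (\<lambda>z. Arg z / (2 * pi))"
    by (intro continuous_intros continuous_at_Arg) auto
  then show ?thesis
    using assms unfolding continuous_at_open by force
qed

section \<open>The homomorphism onto the torus\<close>

context real_frechet_space
begin

lemma torus_quotient:
  assumes "infinite_dimensional"
  shows "has_quotient_group (additive_group :: 'a monoid) euclidean torus_group torus_topology"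
proof -
  obtain f :: "nat \<Rightarrow> 'a \<Rightarrow> real" where f: "\<forall>n. f n \<in> dual"
    and interpolate: "\<forall>t. (\<forall>n. \<bar>t n\<bar> \<le> 1) \<longrightarrow> (\<exists>z. \<forall>n. f n z = t n)"
    and interpolate_nbhd: "\<forall>U. open U \<longrightarrow> 0 \<in> U \<longrightarrow> (\<exists>N::nat. \<exists>W. (\<forall>k. open (W k) \<and> 0 \<in> W k) \<and>
      (\<forall>t. (\<forall>n. \<bar>t n\<bar> \<le> 1) \<longrightarrow> (\<forall>k<N. t k \<in> W k) \<longrightarrow> (\<exists>z\<in>U. \<forall>n. f n z = t n)))"
    using interpolating_functionals[OF assms] by (elim exE conjE)
  have f_add: "f n (x + y) = f n x + f n y" for n x y
    using f unfolding dual_def Vector_Spaces.linear_iff by blast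
  define \<phi> where "\<phi> x = (\<lambda>n. cis (2 * pi * f n x))" for x
  have \<phi>_add: "\<phi> (x + y) n = \<phi> x n * \<phi> y n" for x y n
    by (simp add: \<phi>_def f_add distrib_left cis_mult)
  have norm_\<phi>: "norm (\<phi> x n) = 1" for x n
    by (simp add: \<phi>_def)
  have \<phi>_turn: "\<phi> z = w" if "\<And>n. norm (w n) = 1" "\<And>n. f n z = Arg (w n) / (2 * pi)" for z w
    using that cis_Arg_turn by (simp add: \<phi>_def fun_eq_iff)
  show ?thesis
  proof (rule has_quotient_group_if_open_hom[where h = \<phi>])
    show "group (additive_group :: 'a monoid)"
      by (rule group_additive_group)
    show "\<phi> \<in> hom additive_group torus_group"
      by (auto simp: hom_def carrier_torus_group mult_torus_group additive_group_def norm_\<phi> \<phi>_add)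
    have "continuous_on UNIV (\<lambda>x. \<phi> x n)" for n
      unfolding \<phi>_def using f by (intro continuous_intros) (simp add: dual_def)
    then show "continuous_map euclidean torus_topology \<phi>"
      by (simp add: torus_topology_def circle_topology_def circle_group_def continuous_map_componentwise_UNIV
          continuous_map_in_subtopology norm_\<phi> image_subset_iff)
    show "\<phi> ` carrier additive_group = carrier torus_group"
    proof
      show "carrier torus_group \<subseteq> \<phi> ` carrier additive_group"
      proof
        fix w
        assume "w \<in> carrier torus_group"
        then have w: "norm (w n) = 1" for n
          by (simp add: carrier_torus_group)
        obtain z where "\<And>n. f n z = Arg (w n) / (2 * pi)"
          using interpolate[rule_format, of "\<lambda>n. Arg (w n) / (2 * pi)"] abs_Arg_turn_le by blast
        with w have "\<phi> z = w"
          by (intro \<phi>_turn)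
        then show "w \<in> \<phi> ` carrier additive_group"
          by (auto simp: additive_group_def)
      qed
    qed (auto simp: carrier_torus_group norm_\<phi>)
    show "open_map euclidean torus_topology \<phi>"
      unfolding open_map_def
    proof (intro allI impI)
      fix U :: "'a set"
      assume "openin euclidean U"
      then have U: "open U"
        by simp
      show "openin torus_topology (\<phi> ` U)"
      proof (rule openin_torus_topologyI)
        show "\<phi> ` U \<subseteq> topspace torus_topology"
          by (auto simp: topspace_torus_topology norm_\<phi>)
      next
        fix w
        assume "w \<in> \<phi> ` U"
        then obtain x where x: "x \<in> U" "w = \<phi> x"
          by blast
        \<comment> \<open>Translation by \<open>x\<close> reduces openness to neighbourhoods of
          \<open>0\<close>.\<close>
        have nbhd: "open ((+) x -` U)" "0 \<in> (+) x -` U"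
          using U x by (auto intro!: open_vimage continuous_intros)
        obtain N :: nat and W where W: "\<forall>k. open (W k) \<and> 0 \<in> W k"
          and ex: "\<forall>t. (\<forall>n. \<bar>t n\<bar> \<le> 1) \<longrightarrow> (\<forall>k<N. t k \<in> W k) \<longrightarrow>
            (\<exists>z\<in>(+) x -` U. \<forall>n. f n z = t n)"
          using interpolate_nbhd[rule_format, OF nbhd] by (elim exE conjE)
        have "\<forall>k. \<exists>B. open B \<and> 1 \<in> B \<and> (\<forall>z\<in>B. Arg z / (2 * pi) \<in> W k)"
          using continuous_Arg_turn W by blast
        from choice[OF this] obtain B
          where B: "\<forall>k. open (B k) \<and> 1 \<in> B k \<and> (\<forall>z\<in>B k. Arg z / (2 * pi) \<in> W k)" ..
        \<comment> \<open>For \<open>v k\<close> in \<open>C k\<close> the quotient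
          \<open>v k / \<phi> x k\<close> lies in \<open>B k\<close>, near \<open>1\<close>; its
          small angle is interpolated by some \<open>z\<close>, and \<open>x + z\<close> is then a
          preimage of \<open>v\<close> in \<open>U\<close>.\<close>
        define C where "C k = (\<lambda>z. z / \<phi> x k) -` B k" for k
        have nz: "\<phi> x k \<noteq> 0" for k
          using norm_\<phi>[of x k] by auto
        have "open (C k) \<and> w k \<in> C k" for k
          unfolding C_def using B nz by (auto simp: x(2) intro!: open_vimage continuous_intros)
        moreover have "v \<in> \<phi> ` U" if v: "v \<in> topspace torus_topology" "\<forall>k<N. v k \<in> C k" for v
        proof -
          define u where "u k = v k / \<phi> x k" for k
          have u: "norm (u n) = 1" for n
            using v(1) norm_\<phi> by (simp add: u_def topspace_torus_topology norm_divide)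
          obtain z where z: "x + z \<in> U" "\<And>n. f n z = Arg (u n) / (2 * pi)"
            using ex[rule_format, of "\<lambda>n. Arg (u n) / (2 * pi)"] abs_Arg_turn_le v(2) B
            by (auto simp: C_def u_def)
          have "\<phi> z = u"
            using u z(2) by (intro \<phi>_turn)
          then have "\<phi> (x + z) = v"
            using nz by (simp add: fun_eq_iff \<phi>_add u_def)
          with z(1) show ?thesis
            by blast
        qed
        ultimately show "\<exists>N C. (\<forall>k. open (C k) \<and> w k \<in> C k) \<and>
            (\<forall>v\<in>topspace torus_topology. (\<forall>k<N. v k \<in> C k) \<longrightarrow> v \<in> \<phi> ` U)"
          by blast
      qed
    qed
  qed (simp_all add: group_torus_group t1_space_torus_topology
      carrier_torus_group topspace_torus_topology additive_group_def)
qed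

end

section \<open>Restriction of scalars and the two kinds of spaces\<close>

lemma real_space_restrict_scalars:
  fixes scl :: "'f::real_normed_field \<Rightarrow> 'a::ab_group_add \<Rightarrow> 'a"
  assumes "vector_space scl"
  shows "real_space (\<lambda>r. scl (of_real r))"
proof -
  interpret vector_space scl
    by fact
  show ?thesis
    by unfold_locales (auto simp: scale_right_distrib scale_left_distrib)
qed

text \<open>Real spans lie inside spans over the larger field, so a finite set spanning over the
  reals would span there too.\<close>

lemma infinite_dimensional_restrict_scalars:
  fixes scl :: "'f::real_normed_field \<Rightarrow> 'a::ab_group_add \<Rightarrow> 'a"
  assumes "vector_space scl" "vector_space.infinite_dimensional scl"
  shows "vector_space.infinite_dimensional (\<lambda>r. scl (of_real r))"
proof -
  interpret F: vector_space scl
    by fact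
  interpret R: real_space "\<lambda>r. scl (of_real r)"
    using assms(1) by (rule real_space_restrict_scalars)
  have "R.span B \<subseteq> F.span B" for B
    by (rule R.span_minimal)
      (auto simp: R.subspace_def F.span_superset F.span_zero F.span_add F.span_scale)
  then show ?thesis
    using assms(2) unfolding F.infinite_dimensional_def R.infinite_dimensional_def by blast
qed

lemma frechet_space_torus_quotient:
  fixes scl :: "'f::real_normed_field \<Rightarrow> 'a::{uniform_topological_group_add, ab_group_add} \<Rightarrow> 'a"
  assumes "frechet_space scl" and inf: "vector_space.infinite_dimensional scl"
  shows "has_quotient_group (additive_group :: 'a monoid) euclidean torus_group torus_topology"
proof -
  interpret F: frechet_space scl
    by fact
  let ?s = "\<lambda>r. scl (of_real r)"
  interpret R: real_space ?s
    by (rule real_space_restrict_scalars) unfold_locales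
  have "continuous_on UNIV (\<lambda>p::real \<times> 'a. (of_real (fst p) :: 'f, snd p))"
    by (intro continuous_intros)
  from continuous_on_compose2[OF F.continuous_scale this]
  have cont: "continuous_on UNIV (\<lambda>(r, x). ?s r x)"
    by (simp add: case_prod_unfold)
  have complete: "\<exists>z. S \<longlonglongrightarrow> z"
    if S: "\<And>U. open U \<Longrightarrow> 0 \<in> U \<Longrightarrow> \<exists>N. \<forall>m\<ge>N. \<forall>n\<ge>N. S m - S n \<in> U" for S :: "nat \<Rightarrow> 'a"
  proof -
    have "Cauchy S"
      unfolding Cauchy_uniform_iff
    proof (intro allI impI)
      fix P :: "'a \<times> 'a \<Rightarrow> bool"
      assume "eventually P uniformity"
      \<comment> \<open>The uniformity is the pullback of \<open>nhds 0\<close> along differences,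
        which turns the Cauchy condition into the one on neighbourhoods of \<open>0\<close>.\<close>
      then obtain Q where Q: "eventually Q (nhds 0)" "\<And>a b. Q (b - a) \<Longrightarrow> P (a, b)"
        unfolding cauchy_seq_finset_iff_vanishing eventually_filtercomap by auto
      then obtain U where U: "open U" "0 \<in> U" "\<And>a. a \<in> U \<Longrightarrow> Q a"
        unfolding eventually_nhds by blast
      then show "\<exists>N. \<forall>n\<ge>N. \<forall>m\<ge>N. P (S n, S m)"
        using S[OF U(1,2)] Q(2) by blast
    qed
    then have "\<exists>z. filtermap S sequentially \<le> nhds z"
      unfolding Cauchy_uniform
      by (rule cauchy_filter_complete_converges[OF _ F.complete_UNIV]) (auto simp: filtermap_bot_iff)
    then show ?thesis
      by (simp add: filterlim_def)
  qed
  have "real_frechet_space ?s"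
    using cont F.metrizable complete F.locally_convex by unfold_locales auto
  moreover have "R.infinite_dimensional"
    using inf by (intro infinite_dimensional_restrict_scalars) unfold_locales
  ultimately show ?thesis
    by (rule real_frechet_space.torus_quotient)
qed

lemma banach_space_torus_quotient:
  fixes scl :: "'f::real_normed_field \<Rightarrow> 'a::banach \<Rightarrow> 'a"
  assumes "banach_space scl" and inf: "vector_space.infinite_dimensional scl"
  shows "has_quotient_group (additive_group :: 'a monoid) euclidean torus_group torus_topology"
proof -
  interpret B: banach_space scl
    by fact
  let ?s = "\<lambda>r. scl (of_real r)"
  interpret R: real_space ?s
    by (rule real_space_restrict_scalars) unfold_locales
  have norm_s: "norm (?s r x) = \<bar>r\<bar> * norm x" for r x
    by (simp add: B.norm_scale)
  have "((\<lambda>p. ?s (fst p) (snd p)) \<longlongrightarrow> ?s c x) (at (c, x))" for c x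
  proof -
    have "((\<lambda>p. \<bar>fst p - c\<bar> * norm (snd p) + \<bar>c\<bar> * norm (snd p - x)) \<longlongrightarrow>
        \<bar>fst (c, x) - c\<bar> * norm (snd (c, x)) + \<bar>c\<bar> * norm (snd (c, x) - x)) (at (c, x))"
      by (intro tendsto_intros)
    then have lim: "((\<lambda>p. \<bar>fst p - c\<bar> * norm (snd p) + \<bar>c\<bar> * norm (snd p - x)) \<longlongrightarrow> 0) (at (c, x))"
      by simp
    \<comment> \<open>Joint continuity follows by changing first the scalar, then the vector; the
      right-hand side tends to \<open>0\<close>.\<close>
    have "norm (?s (fst p) (snd p) - ?s c x) \<le>
        \<bar>fst p - c\<bar> * norm (snd p) + \<bar>c\<bar> * norm (snd p - x)" for p
    proof -
      have "?s (fst p) (snd p) - ?s c x = ?s (fst p - c) (snd p) + ?s c (snd p - x)"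
        using R.scale_left_diff_distrib R.scale_right_diff_distrib by simp
      then show ?thesis
        by (metis norm_s norm_triangle_ineq)
    qed
    then have "((\<lambda>p. ?s (fst p) (snd p) - ?s c x) \<longlongrightarrow> 0) (at (c, x))"
      by (intro Lim_null_comparison[OF _ lim]) auto
    then show ?thesis
      by (simp add: LIM_zero_iff)
  qed
  then have cont: "continuous_on UNIV (\<lambda>(c, x). ?s c x)"
    by (auto simp: continuous_on_def case_prod_unfold)
  have complete: "\<exists>z. S \<longlonglongrightarrow> z"
    if S: "\<And>U. open U \<Longrightarrow> 0 \<in> U \<Longrightarrow> \<exists>N. \<forall>m\<ge>N. \<forall>n\<ge>N. S m - S n \<in> U" for S :: "nat \<Rightarrow> 'a"
  proof -
    have "Cauchy S"
    proof (rule CauchyI)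
      fix e :: real
      assume "e > 0"
      then show "\<exists>M. \<forall>m\<ge>M. \<forall>n\<ge>M. norm (S m - S n) < e"
        using S[of "ball 0 e"] by simp
    qed
    then show ?thesis
      by (simp add: Cauchy_convergent_iff convergent_def)
  qed
  have convex: "\<exists>V. open V \<and> 0 \<in> V \<and> V \<subseteq> U \<and> (\<forall>x\<in>V. \<forall>y\<in>V. \<forall>u\<ge>0. \<forall>v\<ge>0. u + v = 1 \<longrightarrow>
      ?s u x + ?s v y \<in> V)" if U: "open U" "0 \<in> U" for U :: "'a set"
  proof -
    obtain e where e: "e > 0" "ball 0 e \<subseteq> U"
      using U by (meson open_contains_ball)
    have "?s u x + ?s v y \<in> ball 0 e"
      if "x \<in> ball 0 e" "y \<in> ball 0 e" "u \<ge> 0" "v \<ge> 0" "u + v = 1" for x y u v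
    proof -
      have "norm (?s u x + ?s v y) \<le> u * norm x + v * norm y"
        using norm_triangle_ineq[of "?s u x" "?s v y"] that by (simp add: norm_s)
      also have "\<dots> < e"
        using that by (intro convex_bound_lt) auto
      finally show ?thesis
        by simp
    qed
    with e show ?thesis
      by (intro exI[of _ "ball 0 e"]) auto
  qed
  have "real_frechet_space ?s"
    using cont metrizable_space_euclidean complete convex by unfold_locales auto
  moreover have "R.infinite_dimensional"
    using inf by (intro infinite_dimensional_restrict_scalars) unfold_locales
  ultimately show ?thesis
    by (rule real_frechet_space.torus_quotient)
qed

theorem corollary2p2:
  fixes scaleF_real :: "real \<Rightarrow> 'a::{uniform_topological_group_add, ab_group_add} \<Rightarrow> 'a"
    and scaleF_complex :: "complex \<Rightarrow> 'a \<Rightarrow> 'a"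
    and scaleB_real :: "real \<Rightarrow> 'b::banach \<Rightarrow> 'b"
    and scaleB_complex :: "complex \<Rightarrow> 'b \<Rightarrow> 'b"
  shows
    "(frechet_space scaleF_real \<and> vector_space.infinite_dimensional scaleF_real \<longrightarrow>
        has_quotient_group (additive_group :: 'a monoid) euclidean torus_group torus_topology) \<and>
     (frechet_space scaleF_complex \<and> vector_space.infinite_dimensional scaleF_complex \<longrightarrow>
        has_quotient_group (additive_group :: 'a monoid) euclidean torus_group torus_topology) \<and>
     (banach_space scaleB_real \<and> vector_space.infinite_dimensional scaleB_real \<longrightarrow>
        has_quotient_group (additive_group :: 'b monoid) euclidean torus_group torus_topology) \<and>
     (banach_space scaleB_complex \<and> vector_space.infinite_dimensional scaleB_complex \<longrightarrow>
        has_quotient_group (additive_group :: 'b monoid) euclidean torus_group torus_topology)"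
  by (auto intro: frechet_space_torus_quotient banach_space_torus_quotient)

end
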